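(* Let $S$ be a finite or countable set, let $P=(P(x,y))_{x,y\in S}$ be a matrix of transition probabilities on $S$ such that, for all $x,y\in S$, $P(x,y)=0$ implies $P(y,x)=0$, and let $\pi:S\to(0,\infty)$, $\sum_{x}\pi(x)<\infty$, be an invariant distribution of $P$, with corresponding vorticity $\Gamma(x,y)=\pi(x)P(x,y)-\pi(y)P(y,x)$. If one uses $Q=P$ as proposal chain and $\Gamma$ as vorticity matrix in the non-reversible Metropolis-Hastings algorithm with target distribution $\pi$, then the resulting transition matrix $P_\Gamma$ is identical to $P$.
   Context: $\pi$ is invariant for $P$ if $\sum_x\pi(x)P(x,y)=\pi(y)$ for all $y$. Non-reversible Metropolis-Hastings (NRMH): given transition probabilities $Q$, a matrix $\Gamma$ that is skew-symmetric with $\sum_y\Gamma(x,y)=0$ for all $x$, and $\pi$, define for $x,y\in S$ $$R_\Gamma(x,y) = \frac{\Gamma(x,y)+\pi(y)Q(y,x)}{\pi(x)Q(x,y)} \ \text{ if } \pi(x)Q(x,y)\neq 0, \qquad R_\Gamma(x,y)=1 \ \text{ otherwise},$$ $A_\Gamma(x,y)=\min(1,R_\Gamma(x,y))$, and $$P_\Gamma(x,y)=Q(x,y)A_\Gamma(x,y)\ \ (x\ne y),\qquad P_\Gamma(x,x)=Q(x,x)+\sum_{z\neq x}Q(x,z)(1-A_\Gamma(x,z)).$$ *)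

theory Defs
  imports "HOL-Library.Countable_Set" "HOL-Analysis.Infinite_Sum"
begin

text \<open>The state space is a carrier set \<open>S\<close>; matrices on \<open>S\<close> are functions of two arguments
  of which only the values on \<open>S\<close> matter.\<close>

definition transition_matrix :: "'a set \<Rightarrow> ('a \<Rightarrow> 'a \<Rightarrow> real) \<Rightarrow> bool" where
  "transition_matrix S P \<longleftrightarrow>
     (\<forall>x\<in>S. \<forall>y\<in>S. 0 \<le> P x y) \<and> (\<forall>x\<in>S. ((\<lambda>y. P x y) has_sum 1) S)"

definition invariant :: "'a set \<Rightarrow> ('a \<Rightarrow> real) \<Rightarrow> ('a \<Rightarrow> 'a \<Rightarrow> real) \<Rightarrow> bool" where
  "invariant S \<pi> P \<longleftrightarrow> (\<forall>y\<in>S. ((\<lambda>x. \<pi> x * P x y) has_sum \<pi> y) S)"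

definition vorticity :: "('a \<Rightarrow> real) \<Rightarrow> ('a \<Rightarrow> 'a \<Rightarrow> real) \<Rightarrow> 'a \<Rightarrow> 'a \<Rightarrow> real" where
  "vorticity \<pi> P x y = \<pi> x * P x y - \<pi> y * P y x"

text \<open>The matrices admitted as vorticity parameter of non-reversible Metropolis-Hastings (NRMH).\<close>

definition vorticity_matrix :: "'a set \<Rightarrow> ('a \<Rightarrow> 'a \<Rightarrow> real) \<Rightarrow> bool" where
  "vorticity_matrix S \<Gamma> \<longleftrightarrow>
     (\<forall>x\<in>S. \<forall>y\<in>S. \<Gamma> x y = - \<Gamma> y x) \<and> (\<forall>x\<in>S. ((\<lambda>y. \<Gamma> x y) has_sum 0) S)"

definition nrmh_ratio ::
  "('a \<Rightarrow> real) \<Rightarrow> ('a \<Rightarrow> 'a \<Rightarrow> real) \<Rightarrow> ('a \<Rightarrow> 'a \<Rightarrow> real) \<Rightarrow> 'a \<Rightarrow> 'a \<Rightarrow> real" where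
  "nrmh_ratio \<pi> Q \<Gamma> x y =
     (if \<pi> x * Q x y \<noteq> 0 then (\<Gamma> x y + \<pi> y * Q y x) / (\<pi> x * Q x y) else 1)"

definition nrmh_accept ::
  "('a \<Rightarrow> real) \<Rightarrow> ('a \<Rightarrow> 'a \<Rightarrow> real) \<Rightarrow> ('a \<Rightarrow> 'a \<Rightarrow> real) \<Rightarrow> 'a \<Rightarrow> 'a \<Rightarrow> real" where
  "nrmh_accept \<pi> Q \<Gamma> x y = min 1 (nrmh_ratio \<pi> Q \<Gamma> x y)"

text \<open>The sum below never takes the default value of a divergent \<open>infsum\<close> when \<open>Q\<close> is a transition
  matrix, \<open>\<Gamma>\<close> is a vorticity matrix and \<open>\<pi>\<close> is positive and summable: its terms are then
  nonnegative and dominated by \<open>Q x z + (\<bar>\<Gamma> x z\<bar> + \<pi> z * Q z x) / \<pi> x\<close>, which is summable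
  over \<open>z \<in> S\<close>.\<close>

definition nrmh ::
  "'a set \<Rightarrow> ('a \<Rightarrow> real) \<Rightarrow> ('a \<Rightarrow> 'a \<Rightarrow> real) \<Rightarrow> ('a \<Rightarrow> 'a \<Rightarrow> real) \<Rightarrow> 'a \<Rightarrow> 'a \<Rightarrow> real" where
  "nrmh S \<pi> Q \<Gamma> x y =
     (if x \<noteq> y then Q x y * nrmh_accept \<pi> Q \<Gamma> x y
      else Q x x + (\<Sum>\<^sub>\<infinity>z\<in>S - {x}. Q x z * (1 - nrmh_accept \<pi> Q \<Gamma> x z)))"

end

theory Submission
  imports Defs
begin

text \<open>The ratio of non-reversible Metropolis-Hastings compares the skewed reverse flow
  \<open>\<Gamma> x y + \<pi> y * Q y x\<close> with the forward flow \<open>\<pi> x * Q x y\<close>. For \<open>Q = P\<close> the vorticity of \<open>P\<close> is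
  exactly the difference of the two flows, so they agree and every proposal is accepted
  (\<open>nrmh_accept_vorticity\<close>); a chain all of whose proposals are accepted is its proposal chain. That
  the vorticity is an admissible parameter is where invariance enters: in the row sum at \<open>x\<close>, the
  flow out of \<open>x\<close> and the flow into \<open>x\<close> both equal \<open>\<pi> x\<close> (\<open>vorticity_matrix_vorticity\<close>).\<close>

lemma vorticity_matrix_vorticity:
  assumes "transition_matrix S P" and "invariant S \<pi> P"
  shows "vorticity_matrix S (vorticity \<pi> P)"
proof -
  have "((\<lambda>y. vorticity \<pi> P x y) has_sum 0) S" if "x \<in> S" for x
  proof -
    have outflow: "((\<lambda>y. \<pi> x * P x y) has_sum \<pi> x) S"
      using assms(1) that has_sum_cmult_right[of "P x" S 1 "\<pi> x"]
      by (simp add: transition_matrix_def)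
    have inflow: "((\<lambda>y. \<pi> y * P y x) has_sum \<pi> x) S"
      using assms(2) that by (simp add: invariant_def)
    have "((\<lambda>y. \<pi> x * P x y + - (\<pi> y * P y x)) has_sum (\<pi> x + - \<pi> x)) S"
      using inflow by (intro has_sum_add outflow) (simp add: has_sum_uminus)
    then show ?thesis
      by (simp add: vorticity_def)
  qed
  then show ?thesis
    by (simp add: vorticity_matrix_def vorticity_def)
qed

text \<open>Adding the vorticity to the reverse flow gives the forward flow, so the ratio is the forward
  flow divided by itself; when that flow vanishes, the ratio is 1 by convention.\<close>

lemma nrmh_accept_vorticity: "nrmh_accept \<pi> P (vorticity \<pi> P) x y = 1"
  by (simp add: nrmh_accept_def nrmh_ratio_def vorticity_def)

lemma nrmh_vorticity: "nrmh S \<pi> P (vorticity \<pi> P) x y = P x y"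
  by (simp add: nrmh_def nrmh_accept_vorticity)

theorem proposition2p8:
  fixes S :: "'a set" and P :: "'a \<Rightarrow> 'a \<Rightarrow> real" and \<pi> :: "'a \<Rightarrow> real"
  assumes "countable S"
    and "transition_matrix S P"
    and "\<And>x y. x \<in> S \<Longrightarrow> y \<in> S \<Longrightarrow> P x y = 0 \<Longrightarrow> P y x = 0"
    and "\<And>x. x \<in> S \<Longrightarrow> 0 < \<pi> x"
    and "\<pi> summable_on S"
    and "invariant S \<pi> P"
  shows "vorticity_matrix S (vorticity \<pi> P) \<and>
         (\<forall>x\<in>S. \<forall>y\<in>S. nrmh S \<pi> P (vorticity \<pi> P) x y = P x y)"
  using vorticity_matrix_vorticity[OF assms(2,6)] by (simp add: nrmh_vorticity)

end
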